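(* Let $\theta\in(0,1)$ be an irrational number of finite type (bounded partial quotients). Then for every $x\in[0,1)$: $|S_n(x)|\notin o(\log n)$; if $m_n(x)\in o(\log n)$ then $M_n(x)\sim\log n$; and, vice versa, if $M_n(x)\in o(\log n)$ then $|m_n(x)|\sim\log n$. Here $u_n\sim\log n$ means that for all sufficiently large $n$ the ratio $u_n/\log n$ is bounded away from both zero and infinity.
   Context: Let $f=\chi_{[0,1/2)}-\chi_{[1/2,1)}$ on $[0,1)$ (addition modulo one). Put $S_n(x)=\sum_{i=0}^{n-1}f(x+i\theta)$, and for $n\ge2$ put $M_n(x)=\max\{S_i(x):i=1,\dots,n-1\}$ and $m_n(x)=\min\{S_i(x):i=1,\dots,n-1\}$. *)

theory Defs
  imports Complex_Main "HOL-Library.Indicator_Function" "HOL-Library.Landau_Symbols"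
begin

text \<open>Regular continued fraction expansion: the complete quotients are
  \<open>r\<^sub>0 = \<theta>\<close> and \<open>r\<^sub>k\<^sub>+\<^sub>1 = 1 / frac r\<^sub>k\<close>, and the partial quotients are their integer parts.
  Only used for irrational \<open>\<theta>\<close>, where no division by zero occurs.\<close>

primrec complete_quotient :: "real \<Rightarrow> nat \<Rightarrow> real" where
  "complete_quotient \<theta> 0 = \<theta>"
| "complete_quotient \<theta> (Suc k) = 1 / frac (complete_quotient \<theta> k)"

definition partial_quotient :: "real \<Rightarrow> nat \<Rightarrow> int" where
  "partial_quotient \<theta> k = \<lfloor>complete_quotient \<theta> k\<rfloor>"

definition finite_type :: "real \<Rightarrow> bool" where
  "finite_type \<theta> \<longleftrightarrow> \<theta> \<notin> \<rat> \<and> bdd_above (range (partial_quotient \<theta>))"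

definition half_fun :: "real \<Rightarrow> real" where
  "half_fun x = indicator {0..<1/2} x - indicator {1/2..<1} x"

definition erg_sum :: "real \<Rightarrow> nat \<Rightarrow> real \<Rightarrow> real" where
  "erg_sum \<theta> n x = (\<Sum>i<n. half_fun (frac (x + real i * \<theta>)))"

text \<open>Meaningful for \<open>n \<ge> 2\<close> only; for smaller \<open>n\<close> the index set is empty and the value is
  unspecified.\<close>

definition max_sum :: "real \<Rightarrow> nat \<Rightarrow> real \<Rightarrow> real" where
  "max_sum \<theta> n x = Max ((\<lambda>i. erg_sum \<theta> i x) ` {1..n - 1})"

definition min_sum :: "real \<Rightarrow> nat \<Rightarrow> real \<Rightarrow> real" where
  "min_sum \<theta> n x = Min ((\<lambda>i. erg_sum \<theta> i x) ` {1..n - 1})"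

text \<open>This is \<open>u n \<sim> log n\<close> in the sense of comparable growth, not the asymptotic equivalence
  (ratio tending to 1) of the library.\<close>

definition comparable_log :: "(nat \<Rightarrow> real) \<Rightarrow> bool" where
  "comparable_log u \<longleftrightarrow>
     (\<exists>c>0. \<exists>C. \<forall>\<^sub>F n in sequentially. c \<le> u n / ln (real n) \<and> u n / ln (real n) \<le> C)"

end

theory Submission
  imports Defs
begin

text \<open>For odd \<open>q\<close> every sum \<open>S\<^sub>q\<close> is an odd integer, hence nonzero. Take an orbit window of length
  \<open>L\<close> and an odd convergent denominator \<open>q\<close> so large that no point of the window comes within
  distance \<open>\<parallel>q \<theta>\<parallel>\<close> of a discontinuity; such a window occurs among the first \<open>2 L\<close> times.
  Translation by \<open>q\<close> then repeats the profile of the Birkhoff sums over the window, shifted by the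
  constant \<open>S\<^sub>q \<noteq> 0\<close>, so the oscillation grows by at least 1. For bounded type, \<open>q\<close> may be chosen
  comparable to \<open>L\<close>, and iterating gives oscillation \<open>\<ge> c log n\<close> along every orbit. The matching
  upper bound \<open>C log n\<close> follows from a Denjoy--Koksma inequality.\<close>

section \<open>Continued fraction denominators\<close>

text \<open>Indices are shifted by one against the usual \<open>p\<^sub>k / q\<^sub>k\<close>: index \<open>0\<close> stands for
  \<open>p\<^sub>-\<^sub>1 = 1\<close>, \<open>q\<^sub>-\<^sub>1 = 0\<close>.\<close>

fun cf_num :: "real \<Rightarrow> nat \<Rightarrow> int" where
  "cf_num \<theta> 0 = 1"
| "cf_num \<theta> (Suc 0) = partial_quotient \<theta> 0"
| "cf_num \<theta> (Suc (Suc k)) = partial_quotient \<theta> (Suc k) * cf_num \<theta> (Suc k) + cf_num \<theta> k"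

fun cf_den :: "real \<Rightarrow> nat \<Rightarrow> int" where
  "cf_den \<theta> 0 = 0"
| "cf_den \<theta> (Suc 0) = 1"
| "cf_den \<theta> (Suc (Suc k)) = partial_quotient \<theta> (Suc k) * cf_den \<theta> (Suc k) + cf_den \<theta> k"

lemma complete_quotient_irrational:
  assumes "\<theta> \<notin> \<rat>"
  shows "complete_quotient \<theta> k \<notin> \<rat>"
proof (induction k)
  case (Suc k)
  show ?case
  proof
    assume "complete_quotient \<theta> (Suc k) \<in> \<rat>"
    then have "1 / complete_quotient \<theta> (Suc k) \<in> \<rat>"
      by (intro Rats_divide) auto
    then have "frac (complete_quotient \<theta> k) \<in> \<rat>"
      by simp
    then have "frac (complete_quotient \<theta> k) + of_int \<lfloor>complete_quotient \<theta> k\<rfloor> \<in> \<rat>"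
      by (intro Rats_add) auto
    then show False
      using Suc by (simp add: frac_def)
  qed
qed (use assms in simp)

lemma complete_quotient_gt_1:
  assumes "\<theta> \<notin> \<rat>"
  shows "complete_quotient \<theta> (Suc k) > 1"
proof -
  have "complete_quotient \<theta> k \<notin> \<int>"
    using complete_quotient_irrational[OF assms, of k] Ints_subset_Rats by blast
  then have "0 < frac (complete_quotient \<theta> k)" "frac (complete_quotient \<theta> k) < 1"
    by (simp_all add: frac_gt_0_iff frac_lt_1)
  then show ?thesis by simp
qed

lemma partial_quotient_ge_1: "\<theta> \<notin> \<rat> \<Longrightarrow> partial_quotient \<theta> (Suc k) \<ge> 1"
  using complete_quotient_gt_1[of \<theta> k] unfolding partial_quotient_def by linarith

lemma cf_den_mono_Suc:
  assumes "\<theta> \<notin> \<rat>"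
  shows "0 \<le> cf_den \<theta> k \<and> cf_den \<theta> k \<le> cf_den \<theta> (Suc k) \<and> 1 \<le> cf_den \<theta> (Suc k)"
proof (induction k)
  case (Suc k)
  have "1 * cf_den \<theta> (Suc k) \<le> partial_quotient \<theta> (Suc k) * cf_den \<theta> (Suc k)"
    using Suc partial_quotient_ge_1[OF assms] by (intro mult_right_mono) auto
  then have "cf_den \<theta> (Suc k) \<le> cf_den \<theta> (Suc (Suc k))"
    using Suc unfolding cf_den.simps(3) by linarith
  then show ?case using Suc by linarith
qed simp

text \<open>Each recurrence step adds an earlier denominator of size at least 1. Being unbounded,
  the denominators pass any given \<open>N\<close>.\<close>

lemma cf_den_ge:
  assumes "\<theta> \<notin> \<rat>"
  shows "int k \<le> cf_den \<theta> (Suc k)"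
proof (induction k rule: less_induct)
  case (less k)
  consider "k = 0" | "k = 1" | j where "k = Suc (Suc j)"
    by (metis One_nat_def not0_implies_Suc)
  then show ?case
  proof cases
    case 3
    have "1 * cf_den \<theta> (Suc (Suc j)) \<le> partial_quotient \<theta> (Suc (Suc j)) * cf_den \<theta> (Suc (Suc j))"
      using cf_den_mono_Suc[OF assms, of "Suc j"] partial_quotient_ge_1[OF assms, of "Suc j"]
      by (intro mult_right_mono) auto
    then have "cf_den \<theta> (Suc k) \<ge> cf_den \<theta> (Suc (Suc j)) + cf_den \<theta> (Suc j)"
      unfolding 3 by simp
    then show ?thesis
      using less.IH[of "Suc j"] cf_den_mono_Suc[OF assms, of j] 3 by linarith
  qed (use cf_den_mono_Suc[OF assms, of k] in auto)
qed

text \<open>Passing to the next pair adds a multiple of the newer column to the older one and swaps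
  the two, which only flips the sign of the determinant.\<close>

lemma cf_determinant:
  "cf_num \<theta> (Suc k) * cf_den \<theta> k - cf_num \<theta> k * cf_den \<theta> (Suc k) = (-1) ^ Suc k"
proof (induction k)
  case (Suc k)
  have "cf_num \<theta> (Suc (Suc k)) * cf_den \<theta> (Suc k) - cf_num \<theta> (Suc k) * cf_den \<theta> (Suc (Suc k))
      = - (cf_num \<theta> (Suc k) * cf_den \<theta> k - cf_num \<theta> k * cf_den \<theta> (Suc k))"
    by (simp add: algebra_simps)
  then show ?case using Suc by simp
qed simp

text \<open>This is the Moebius formula for \<theta> in terms of a complete quotient
  \<open>r\<close>, cleared of its denominator. The induction substitutes
  \<open>r = a + 1/s\<close>, with \<open>a\<close> the integer part of \<open>r\<close> and
  \<open>s\<close> the next complete quotient.\<close>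

lemma cf_complete_quotient:
  assumes "\<theta> \<notin> \<rat>"
  shows "\<theta> * (complete_quotient \<theta> (Suc k) * cf_den \<theta> (Suc k) + cf_den \<theta> k)
      = complete_quotient \<theta> (Suc k) * cf_num \<theta> (Suc k) + cf_num \<theta> k"
proof (induction k)
  case 0
  have "frac \<theta> \<noteq> 0"
    using assms Ints_subset_Rats by auto
  moreover have "\<theta> = partial_quotient \<theta> 0 + frac \<theta>"
    by (simp add: partial_quotient_def frac_def)
  ultimately show ?case
    by (simp add: field_simps)
next
  case (Suc k)
  define r where "r = complete_quotient \<theta> (Suc k)"
  define s where "s = complete_quotient \<theta> (Suc (Suc k))"
  define a where "a = real_of_int (partial_quotient \<theta> (Suc k))"
  have "frac r \<noteq> 0"
    using complete_quotient_irrational[OF assms, of "Suc k"] Ints_subset_Rats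
    unfolding r_def by (auto simp del: complete_quotient.simps)
  then have s: "s * (r - a) = 1"
    by (simp add: s_def r_def a_def partial_quotient_def frac_def)
  have "s * (\<theta> * (r * cf_den \<theta> (Suc k) + cf_den \<theta> k)) = s * (r * cf_num \<theta> (Suc k) + cf_num \<theta> k)"
    using Suc unfolding r_def by simp
  moreover have "s * r = s * a + 1"
    using s by (simp add: algebra_simps)
  ultimately have "\<theta> * (s * (a * cf_den \<theta> (Suc k) + cf_den \<theta> k) + cf_den \<theta> (Suc k))
      = s * (a * cf_num \<theta> (Suc k) + cf_num \<theta> k) + cf_num \<theta> (Suc k)"
    by algebra
  then show ?case
    by (simp add: s_def a_def del: complete_quotient.simps)
qed

text \<open>By the Moebius formula, the error times \<open>D\<close> is the determinant up to sign.
  So the error is exactly \<open>1 / D\<close>, and \<open>r > 1\<close> makes \<open>D\<close>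
  exceed the denominator.\<close>

lemma cf_approx:
  fixes \<theta> :: real
  assumes "\<theta> \<notin> \<rat>"
  shows "\<bar>cf_den \<theta> (Suc k) * \<theta> - cf_num \<theta> (Suc k)\<bar> < 1 / cf_den \<theta> (Suc k)"
proof -
  define r where "r = complete_quotient \<theta> (Suc k)"
  define D where "D = r * cf_den \<theta> (Suc k) + cf_den \<theta> k"
  have r: "r > 1" unfolding r_def by (rule complete_quotient_gt_1[OF assms])
  have d: "0 \<le> cf_den \<theta> k" "1 \<le> cf_den \<theta> (Suc k)"
    using cf_den_mono_Suc[OF assms, of k] by auto
  have "1 * real_of_int (cf_den \<theta> (Suc k)) < r * cf_den \<theta> (Suc k)"
    using r d by (intro mult_strict_right_mono) auto
  then have D: "real_of_int (cf_den \<theta> (Suc k)) < D"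
    using d unfolding D_def by linarith
  have det: "real_of_int (cf_num \<theta> (Suc k)) * cf_den \<theta> k - cf_num \<theta> k * cf_den \<theta> (Suc k)
      = (-1) ^ Suc k"
    using arg_cong[OF cf_determinant[of \<theta> k], of real_of_int] by simp
  have "(cf_den \<theta> (Suc k) * \<theta> - cf_num \<theta> (Suc k)) * D
      = - (real_of_int (cf_num \<theta> (Suc k)) * cf_den \<theta> k - cf_num \<theta> k * cf_den \<theta> (Suc k))"
    using cf_complete_quotient[OF assms, of k] unfolding D_def r_def[symmetric] of_int_mult by algebra
  then have "\<bar>(cf_den \<theta> (Suc k) * \<theta> - cf_num \<theta> (Suc k)) * D\<bar> = 1"
    unfolding det by simp
  then have "\<bar>cf_den \<theta> (Suc k) * \<theta> - cf_num \<theta> (Suc k)\<bar> = 1 / D"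
    using D d unfolding abs_mult by (simp add: field_simps)
  also have "\<dots> < 1 / cf_den \<theta> (Suc k)"
    using D d by (intro divide_strict_left_mono) auto
  finally show ?thesis .
qed

lemma cf_coprime: "coprime (cf_num \<theta> k) (cf_den \<theta> k)"
proof (rule coprimeI)
  fix d assume "d dvd cf_num \<theta> k" "d dvd cf_den \<theta> k"
  then have "d dvd cf_num \<theta> (Suc k) * cf_den \<theta> k - cf_num \<theta> k * cf_den \<theta> (Suc k)"
    by simp
  then have "d dvd (-1) ^ Suc k"
    unfolding cf_determinant .
  then show "is_unit d"
    by (metis dvd_minus_iff dvd_trans is_unit_power_iff dvd_refl)
qed

text \<open>Collects the properties of a convergent \<open>p/q\<close> on which the dynamical
  arguments rest. Oddness also excludes \<open>q = 0\<close>.\<close>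

definition good_denominator :: "real \<Rightarrow> nat \<Rightarrow> int \<Rightarrow> bool" where
  "good_denominator \<theta> q p \<longleftrightarrow> odd q \<and> coprime p (int q) \<and> \<bar>real q * \<theta> - of_int p\<bar> < 1 / real q"

text \<open>Bounded partial quotients keep the ratio of consecutive denominators bounded, and two
  consecutive denominators cannot both be even because their determinant is odd.\<close>

lemma finite_type_good_denominators:
  assumes "finite_type \<theta>"
  obtains B :: nat where "\<And>N. N \<ge> 1 \<Longrightarrow> \<exists>q p. N \<le> q \<and> q \<le> B * N \<and> good_denominator \<theta> q p"
proof -
  have irr: "\<theta> \<notin> \<rat>" using assms by (simp add: finite_type_def)
  obtain A0 where A0: "partial_quotient \<theta> k \<le> A0" for k
    using assms unfolding finite_type_def bdd_above_def by auto
  define A where "A = max 0 A0"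
  have A: "partial_quotient \<theta> k \<le> A" "0 \<le> A" for k
    using A0[of k] by (auto simp: A_def)
  have growth: "cf_den \<theta> (Suc (Suc k)) \<le> (A + 1) * cf_den \<theta> (Suc k)" for k
  proof -
    have "partial_quotient \<theta> (Suc k) * cf_den \<theta> (Suc k) \<le> A * cf_den \<theta> (Suc k)"
      using A cf_den_mono_Suc[OF irr, of k] by (intro mult_right_mono) auto
    then show ?thesis
      using cf_den_mono_Suc[OF irr, of k] unfolding cf_den.simps(3) distrib_right by linarith
  qed
  have good: "good_denominator \<theta> (nat (cf_den \<theta> (Suc k))) (cf_num \<theta> (Suc k))"
    if "odd (cf_den \<theta> (Suc k))" for k
    using that cf_approx[OF irr, of k] cf_coprime[of \<theta> "Suc k"] cf_den_mono_Suc[OF irr, of k]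
    unfolding good_denominator_def by (simp add: even_nat_iff)
  \<comment> \<open>One factor \<open>A + 1\<close> pays for overshooting \<open>N\<close>, the
    other for moving on to the next denominator when the first one is even.\<close>
  define B where "B = nat ((A + 1)^2)"
  show ?thesis
  proof
    fix N :: nat assume N: "N \<ge> 1"
    define j where "j = (LEAST k. int N \<le> cf_den \<theta> k)"
    have j: "int N \<le> cf_den \<theta> j"
      unfolding j_def using cf_den_ge[OF irr, of N] by (rule LeastI)
    with N obtain k where k: "j = Suc k"
      by (cases j) auto
    have "k < j" using k by simp
    then have less: "cf_den \<theta> k < int N"
      unfolding j_def by (meson not_less_Least linorder_not_less)
    have "cf_den \<theta> (Suc k) \<le> (A + 1) * int N"
    proof (cases k)
      \<comment> \<open>\<open>growth\<close> only bounds denominators from the second one on; the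
        first is 1.\<close>
      case 0
      have "1 * int N \<le> (A + 1) * int N"
        using A by (intro mult_right_mono) auto
      moreover have "cf_den \<theta> (Suc k) = 1"
        using 0 by simp
      ultimately show ?thesis using N by linarith
    next
      case (Suc i)
      have "(A + 1) * cf_den \<theta> k \<le> (A + 1) * int N"
        using A less by (intro mult_left_mono) auto
      then show ?thesis using growth[of i] Suc by simp
    qed
    moreover from this have "(A + 1) * cf_den \<theta> (Suc k) \<le> (A + 1) * ((A + 1) * int N)"
      using A by (intro mult_left_mono) auto
    moreover have "(A + 1) * int N \<le> (A + 1) * ((A + 1) * int N)"
      using A mult_right_mono[of 1 "A + 1" "int N"] by (intro mult_left_mono) auto
    moreover have "int (B * N) = (A + 1) * ((A + 1) * int N)"
      using A by (simp add: B_def power2_eq_square)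
    ultimately have le: "cf_den \<theta> (Suc k) \<le> int (B * N)" "cf_den \<theta> (Suc (Suc k)) \<le> int (B * N)"
      using growth[of k] by linarith+
    have ge: "int N \<le> cf_den \<theta> (Suc k)" "int N \<le> cf_den \<theta> (Suc (Suc k))"
      using j k cf_den_mono_Suc[OF irr, of "Suc k"] by auto
    have "odd (cf_den \<theta> (Suc k)) \<or> odd (cf_den \<theta> (Suc (Suc k)))"
    proof (rule ccontr)
      assume "\<not> ?thesis"
      then have "even (cf_num \<theta> (Suc (Suc k)) * cf_den \<theta> (Suc k)
          - cf_num \<theta> (Suc k) * cf_den \<theta> (Suc (Suc k)))"
        by (intro dvd_diff dvd_mult) auto
      then show False unfolding cf_determinant by simp
    qed
    then show "\<exists>q p. N \<le> q \<and> q \<le> B * N \<and> good_denominator \<theta> q p"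
    proof
      assume "odd (cf_den \<theta> (Suc k))"
      then show ?thesis using good[of k] le(1) ge(1) by (metis nat_le_iff nat_int nat_mono)
    next
      assume "odd (cf_den \<theta> (Suc (Suc k)))"
      then show ?thesis using good[of "Suc k"] le(2) ge(2)
        by (metis nat_le_iff nat_int nat_mono)
    qed
  qed
qed

section \<open>Birkhoff sums\<close>

text \<open>The floor form turns a Birkhoff sum into a difference of two sums that are monotone in
  the starting point, as the upper bound requires.\<close>

lemma half_fun_frac_floor: "half_fun (frac y) = 1 - 2 * of_int (\<lfloor>y + 1/2\<rfloor> - \<lfloor>y\<rfloor>)"
proof (cases "frac y < 1/2")
  case True
  then have "\<lfloor>y + 1/2\<rfloor> = \<lfloor>y\<rfloor>"
    using frac_ge_0[of y] unfolding frac_def by linarith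
  then show ?thesis
    using True frac_ge_0[of y] frac_lt_1[of y] by (simp add: half_fun_def indicator_def)
next
  case False
  then have "\<lfloor>y + 1/2\<rfloor> = \<lfloor>y\<rfloor> + 1"
    using frac_lt_1[of y] unfolding frac_def by linarith
  then show ?thesis
    using False frac_ge_0[of y] frac_lt_1[of y] by (simp add: half_fun_def indicator_def)
qed

text \<open>The parity form places both discontinuities at the integers of the doubled
  variable.\<close>

lemma half_fun_frac_parity: "half_fun (frac y) = (if even \<lfloor>2 * y\<rfloor> then 1 else -1)"
proof (cases "frac y < 1/2")
  case True
  then have "\<lfloor>2 * y\<rfloor> = 2 * \<lfloor>y\<rfloor>"
    using frac_ge_0[of y] unfolding frac_def by linarith
  then show ?thesis
    using True frac_ge_0[of y] by (simp add: half_fun_def indicator_def)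
next
  case False
  then have "\<lfloor>2 * y\<rfloor> = 2 * \<lfloor>y\<rfloor> + 1"
    using frac_lt_1[of y] unfolding frac_def by linarith
  then show ?thesis
    using False frac_lt_1[of y] by (simp add: half_fun_def indicator_def)
qed

text \<open>The cocycle identity.\<close>

lemma erg_sum_add: "erg_sum \<theta> (m + n) x = erg_sum \<theta> m x + erg_sum \<theta> n (x + real m * \<theta>)"
  by (induction n) (simp_all add: erg_sum_def algebra_simps)

lemma abs_erg_sum_le: "\<bar>erg_sum \<theta> n x\<bar> \<le> real n"
proof -
  have "\<bar>erg_sum \<theta> n x\<bar> \<le> (\<Sum>i<n. \<bar>half_fun (frac (x + real i * \<theta>))\<bar>)"
    unfolding erg_sum_def by (rule sum_abs)
  also have "\<dots> \<le> (\<Sum>i<n. 1)"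
    by (intro sum_mono) (simp add: half_fun_frac_parity)
  finally show ?thesis by simp
qed

lemma erg_sum_parity: "\<exists>k::int. erg_sum \<theta> n x = of_int k \<and> (even k \<longleftrightarrow> even n)"
proof (induction n)
  case 0
  show ?case by (intro exI[of _ 0]) (simp add: erg_sum_def)
next
  case (Suc n)
  then obtain k :: int where k: "erg_sum \<theta> n x = of_int k" "even k \<longleftrightarrow> even n" by blast
  define s :: int where "s = (if even \<lfloor>2 * (x + real n * \<theta>)\<rfloor> then 1 else -1)"
  have "erg_sum \<theta> (Suc n) x = of_int (k + s)"
    using k(1) by (simp add: erg_sum_def half_fun_frac_parity s_def)
  moreover have "odd s" by (simp add: s_def)
  ultimately show ?case
    using k(2) by (intro exI[of _ "k + s"]) simp
qed

section \<open>Upper bound\<close>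

text \<open>With \<open>m\<close> the floor of \<open>q y\<close>, the summands are
  \<open>(m + i p) div q\<close>, and since \<open>p\<close> is invertible modulo \<open>q\<close>
  the remainders run through all residues once. The sum thus depends on \<open>y\<close> only
  through \<open>m\<close>; the other terms stay unevaluated because they cancel in
  differences.\<close>

lemma sum_floor_rational:
  fixes p :: int and q :: nat and y :: real
  assumes "coprime p (int q)" "q > 0"
  shows "int q * (\<Sum>i<q. \<lfloor>y + real i * of_int p / real q\<rfloor>)
    = int q * \<lfloor>real q * y\<rfloor> + p * (\<Sum>i<q. int i) - \<Sum>{0..<int q}"
proof -
  define m where "m = \<lfloor>real q * y\<rfloor>"
  have fl: "\<lfloor>y + real i * of_int p / real q\<rfloor> = (m + int i * p) div int q" for i
  proof -
    have "y + real i * of_int p / real q = (real q * y + of_int (int i * p)) / of_int (int q)"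
      using assms(2) by (simp add: field_simps)
    also have "\<lfloor>\<dots>\<rfloor> = \<lfloor>real q * y + of_int (int i * p)\<rfloor> div int q"
      by (rule floor_divide_real_eq_div) simp
    also have "\<lfloor>real q * y + of_int (int i * p)\<rfloor> = m + int i * p"
      unfolding m_def by (rule floor_add_int[symmetric])
    finally show ?thesis .
  qed
  define g where "g = (\<lambda>i::nat. (m + int i * p) mod int q)"
  have inj: "inj_on g {..<q}"
  proof (rule inj_onI)
    fix i j assume ij: "i \<in> {..<q}" "j \<in> {..<q}" "g i = g j"
    then have "int q dvd (m + int i * p) - (m + int j * p)"
      unfolding g_def by (simp add: mod_eq_dvd_iff)
    also have "(m + int i * p) - (m + int j * p) = p * (int i - int j)"
      by (simp add: algebra_simps)
    finally have "int q dvd int i - int j"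
      using assms(1) by (simp add: coprime_commute coprime_dvd_mult_right_iff)
    then show "i = j"
      using ij(1,2) dvd_imp_le_int[of "int i - int j" "int q"] by (cases "i = j") auto
  qed
  have "g ` {..<q} \<subseteq> {0..<int q}"
    using assms(2) by (auto simp: g_def)
  then have img: "g ` {..<q} = {0..<int q}"
    by (intro card_subset_eq) (simp_all add: card_image[OF inj])
  have "(\<Sum>i<q. g i) = \<Sum>{0..<int q}"
    using sum.reindex[OF inj, of "\<lambda>z. z"] img by simp
  moreover have "int q * ((m + int i * p) div int q) = m + int i * p - g i" for i
    unfolding g_def by (simp add: minus_mod_eq_mult_div)
  ultimately show ?thesis
    unfolding fl m_def[symmetric]
    by (simp add: sum_distrib_left sum.distrib sum_subtractf mult.commute)
qed

lemma sum_floor_shift: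
  fixes y z :: real
  assumes "coprime p (int q)" "q > 0"
  shows "(\<Sum>i<q. \<lfloor>y + real i * of_int p / real q\<rfloor>) - (\<Sum>i<q. \<lfloor>z + real i * of_int p / real q\<rfloor>)
    = \<lfloor>real q * y\<rfloor> - \<lfloor>real q * z\<rfloor>"
proof -
  have "int q * ((\<Sum>i<q. \<lfloor>y + real i * of_int p / real q\<rfloor>)
      - (\<Sum>i<q. \<lfloor>z + real i * of_int p / real q\<rfloor>)) = int q * (\<lfloor>real q * y\<rfloor> - \<lfloor>real q * z\<rfloor>)"
    using sum_floor_rational[OF assms, of y] sum_floor_rational[OF assms, of z]
    by (simp only: right_diff_distrib)
  then show ?thesis using assms(2) by simp
qed

text \<open>Denjoy--Koksma: the orbit of length \<open>q\<close> is compared with the \<open>q\<close> equally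
  spaced points of the rotation by \<open>p/q\<close>.\<close>

lemma erg_sum_good_denominator:
  assumes "good_denominator \<theta> q p"
  shows "\<bar>erg_sum \<theta> q x\<bar> \<le> 6"
proof -
  have q: "q > 0" and cop: "coprime p (int q)" and app: "\<bar>real q * \<theta> - of_int p\<bar> < 1 / real q"
    using assms odd_pos by (auto simp: good_denominator_def)
  define H where "H = (\<lambda>y::real. \<Sum>i<q. \<lfloor>y + real i * of_int p / real q\<rfloor>)"
  define F where "F = (\<lambda>y::real. \<Sum>i<q. \<lfloor>y + real i * \<theta>\<rfloor>)"
  have close: "\<bar>real i * \<theta> - real i * of_int p / real q\<bar> \<le> 1 / real q" if "i < q" for i
  proof -
    have "real i * \<theta> - real i * of_int p / real q = real i / real q * (real q * \<theta> - of_int p)"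
      using q by (simp add: field_simps)
    then have "\<bar>real i * \<theta> - real i * of_int p / real q\<bar>
        = real i / real q * \<bar>real q * \<theta> - of_int p\<bar>"
      by (simp add: abs_mult)
    also have "\<dots> \<le> 1 * (1 / real q)"
      using that q app by (intro mult_mono) auto
    finally show ?thesis by simp
  qed
  \<comment> \<open>Floors are monotone, so moving every orbit point by at most \<open>1/q\<close>
    is absorbed by moving the base point of the rational orbit.\<close>
  have bounds: "H (y - 1 / real q) \<le> F y" "F y \<le> H (y + 1 / real q)" for y
    unfolding H_def F_def using close
    by (auto intro!: sum_mono floor_mono simp: abs_le_iff field_simps)
  have shift: "H y - H z = \<lfloor>real q * y\<rfloor> - \<lfloor>real q * z\<rfloor>" for y z
    unfolding H_def by (rule sum_floor_shift[OF cop q])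
  have "F (x + 1/2) - F x \<le> H (x + 1/2 + 1 / real q) - H (x - 1 / real q)"
    using bounds(1)[of x] bounds(2)[of "x + 1/2"] by linarith
  also have "\<dots> = \<lfloor>real q * x + real q / 2 + 1\<rfloor> - \<lfloor>real q * x - 1\<rfloor>"
    unfolding shift using q by (simp add: algebra_simps)
  finally have up: "F (x + 1/2) - F x \<le> \<lfloor>real q * x + real q / 2 + 1\<rfloor> - \<lfloor>real q * x - 1\<rfloor>" .
  have "\<lfloor>real q * x + real q / 2 - 1\<rfloor> - \<lfloor>real q * x + 1\<rfloor> = H (x + 1/2 - 1 / real q) - H (x + 1 / real q)"
    unfolding shift using q by (simp add: algebra_simps)
  also have "\<dots> \<le> F (x + 1/2) - F x"
    using bounds(2)[of x] bounds(1)[of "x + 1/2"] by linarith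
  finally have lo: "\<lfloor>real q * x + real q / 2 - 1\<rfloor> - \<lfloor>real q * x + 1\<rfloor> \<le> F (x + 1/2) - F x" .
  \<comment> \<open>In the variable \<open>q x\<close> the two displacements cost 1 each and the
    rounding less than 1, so \<open>W\<close> is within 3 of \<open>q/2\<close>. Doubling gives the
    constant 6.\<close>
  define W where "W = F (x + 1/2) - F x"
  have "erg_sum \<theta> q x = real q - 2 * of_int W"
    unfolding erg_sum_def half_fun_frac_floor F_def W_def
    by (simp add: sum_subtractf sum_distrib_left add_ac)
  moreover have "of_int W \<le> real q / 2 + 3"
    using up of_int_floor_le[of "real q * x + real q / 2 + 1"]
      floor_correct[of "real q * x - 1"] unfolding W_def[symmetric] by linarith
  moreover have "real q / 2 - 3 \<le> of_int W"
    using lo of_int_floor_le[of "real q * x + 1"]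
      floor_correct[of "real q * x + real q / 2 - 1"] unfolding W_def[symmetric] by linarith
  ultimately show ?thesis by linarith
qed

lemma erg_sum_mult_good_denominator:
  assumes "good_denominator \<theta> q p"
  shows "\<bar>erg_sum \<theta> (a * q) x\<bar> \<le> 6 * real a"
proof (induction a arbitrary: x)
  case 0
  show ?case by (simp add: erg_sum_def)
next
  case (Suc a)
  have "erg_sum \<theta> (Suc a * q) x = erg_sum \<theta> q x + erg_sum \<theta> (a * q) (x + real q * \<theta>)"
    using erg_sum_add[of \<theta> q "a * q" x] by simp
  then show ?case
    using Suc[of "x + real q * \<theta>"] erg_sum_good_denominator[OF assms, of x] by simp
qed

text \<open>Strong induction: split \<open>n = a q + r\<close> with a good \<open>q\<close>
  comparable to \<open>n\<close>. There are boundedly many blocks, each contributing at most 6, and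
  \<open>r < n/2\<close> lowers the logarithm by at least \<open>ln 2\<close>. Uniformity in
  \<open>x\<close> is needed because the remainder starts elsewhere on the orbit.\<close>

lemma erg_sum_upper_bound:
  assumes "finite_type \<theta>"
  obtains C where "C > 0" "\<And>n x. n \<ge> 1 \<Longrightarrow> \<bar>erg_sum \<theta> n x\<bar> \<le> C * (1 + ln (real n))"
proof -
  obtain B where B: "\<And>N. N \<ge> 1 \<Longrightarrow> \<exists>q p. N \<le> q \<and> q \<le> B * N \<and> good_denominator \<theta> q p"
    using finite_type_good_denominators[OF assms] by blast
  have B1: "B \<ge> 1" using B[of 1] by (cases B) auto
  \<comment> \<open>Chosen so that the gain \<open>C * ln 2\<close> from halving pays for all
    blocks.\<close>
  define C where "C = 12 * real B / ln 2"
  have ln2: "0 < ln (2::real)" "ln (2::real) < 1"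
    using ln_less_self[of 2] ln_2_less_1 by auto
  have C: "C \<ge> 12 * real B"
    using ln2 B1 unfolding C_def by (simp add: field_simps)
  have "\<bar>erg_sum \<theta> n x\<bar> \<le> C * (1 + ln (real n))" if "n \<ge> 1" for n x
    using that
  proof (induction n arbitrary: x rule: less_induct)
    case (less n)
    show ?case
    proof (cases "n < B")
      case True
      \<comment> \<open>Here \<open>n div B\<close> would be 0, so the trivial bound by the length
        is used.\<close>
      have "\<bar>erg_sum \<theta> n x\<bar> \<le> C * 1"
        using abs_erg_sum_le[of \<theta> n x] True C by simp
      also have "\<dots> \<le> C * (1 + ln (real n))"
        using less.prems C by (intro mult_left_mono) auto
      finally show ?thesis .
    next
      case False
      define N where "N = n div B"
      have N1: "N \<ge> 1" unfolding N_def using False B1 by (simp add: Suc_leI div_greater_zero_iff)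
      obtain q p where q: "N \<le> q" "q \<le> B * N" "good_denominator \<theta> q p"
        using B[OF N1] by blast
      define a where "a = n div q"
      define r where "r = n mod q"
      have n: "n = a * q + r" by (simp add: a_def r_def)
      have "B * N \<le> n" by (simp add: N_def)
      then have qn: "q \<le> n" using q by simp
      have "r < q" unfolding r_def using q N1 by simp
      have "a \<ge> 1" unfolding a_def using qn q N1 by (simp add: Suc_leI div_greater_zero_iff)
      then have "1 * q \<le> a * q" by (intro mult_le_mono1)
      then have r2: "2 * r < n" using n \<open>r < q\<close> by linarith
      have "n < B * (N + 1)"
        using B1 dividend_less_times_div[of B n] unfolding N_def by simp
      also have "\<dots> \<le> B * (2 * q)" using q N1 by (intro mult_le_mono2) simp
      finally have "n < (2 * B) * q" by (simp add: mult_ac)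
      then have "a < 2 * B" unfolding a_def using q N1 by (simp add: less_mult_imp_div_less)
      then have "6 * real a \<le> 12 * real B" by simp
      then have aq: "\<bar>erg_sum \<theta> (a * q) x\<bar> \<le> C * ln 2"
        using erg_sum_mult_good_denominator[OF q(3), of a x] ln2 unfolding C_def by simp
      have rr: "\<bar>erg_sum \<theta> r (x + real (a * q) * \<theta>)\<bar> \<le> C * (1 + ln (real n) - ln 2)"
      proof (cases "r = 0")
        case True
        \<comment> \<open>The induction hypothesis needs positive length; for the empty remainder it
          suffices that the bound is nonnegative, which follows from
          \<open>ln 2 < 1\<close>.\<close>
        have "0 \<le> ln (real n)" using less.prems by simp
        then have "C * (ln (real n) - ln 2) \<ge> C * (- 1)"
          using ln2 C by (intro mult_left_mono) linarith+
        then show ?thesis using True by (simp add: erg_sum_def algebra_simps)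
      next
        case False
        then have "ln (real r) \<le> ln (real n / 2)"
          using r2 by (subst ln_le_cancel_iff) auto
        also have "\<dots> = ln (real n) - ln 2"
          using less.prems by (simp add: ln_div)
        finally have "C * (1 + ln (real r)) \<le> C * (1 + ln (real n) - ln 2)"
          using C by (intro mult_left_mono) auto
        then show ?thesis
          using less.IH[of r "x + real (a * q) * \<theta>"] False r2 by force
      qed
      have "erg_sum \<theta> n x = erg_sum \<theta> (a * q) x + erg_sum \<theta> r (x + real (a * q) * \<theta>)"
        unfolding n by (rule erg_sum_add)
      then show ?thesis using aq rr by (simp add: algebra_simps)
    qed
  qed
  moreover have "C > 0" using C B1 by linarith
  ultimately show ?thesis using that by blast
qed

section \<open>Oscillation\<close>

text \<open>Close returns to \<open>{0, 1/2}\<close> are rare: doubling merges the two discontinuities of \<open>f\<close> into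
  the single condition that \<open>2 x + 2 t \<theta>\<close> is close to an integer.\<close>

lemma good_denominator_separation:
  assumes "good_denominator \<theta> q p" and n: "1 \<le> n" "2 * n \<le> q"
  shows "\<bar>real n * \<theta> - of_int k\<bar> \<ge> 1 / (2 * real q)"
proof -
  have q: "q > 0" and cop: "coprime p (int q)" and app: "\<bar>real q * \<theta> - of_int p\<bar> < 1 / real q"
    using assms odd_pos by (auto simp: good_denominator_def)
  \<comment> \<open>Equality would force \<open>q\<close> to divide \<open>n\<close>. Hence
    \<open>n p / q\<close> misses \<open>k\<close> by at least \<open>1/q\<close>, and replacing
    \<open>p/q\<close> by \<theta> costs at most half of that.\<close>
  have "int n * p \<noteq> k * int q"
  proof
    assume "int n * p = k * int q"
    then have "int q dvd p * int n" by (metis dvd_triv_right mult.commute)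
    then have "int q dvd int n"
      using cop by (simp add: coprime_commute coprime_dvd_mult_right_iff)
    then show False using n by (auto dest: dvd_imp_le)
  qed
  then have "1 \<le> \<bar>int n * p - k * int q\<bar>" by linarith
  then have "of_int 1 \<le> (of_int \<bar>int n * p - k * int q\<bar> :: real)"
    by (simp only: of_int_le_iff)
  then have 1: "1 \<le> \<bar>real n * of_int p - of_int k * real q\<bar>" by simp
  have "\<bar>real n * (real q * \<theta> - of_int p)\<bar> \<le> real n * (1 / real q)"
    unfolding abs_mult using app by (intro mult_mono) auto
  also have "\<dots> \<le> 1 / 2"
    using n q by (simp add: field_simps)
  finally have 2: "\<bar>real n * (real q * \<theta> - of_int p)\<bar> \<le> 1 / 2" .
  have "real q * (real n * \<theta> - of_int k)
      = real n * (real q * \<theta> - of_int p) + (real n * of_int p - of_int k * real q)"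
    by (simp add: algebra_simps)
  then have "1 / 2 \<le> \<bar>real q * (real n * \<theta> - of_int k)\<bar>"
    using 1 2 by linarith
  then show ?thesis
    using q unfolding abs_mult by (simp add: field_simps)
qed

text \<open>The doubled perturbation is too small to cross an integer, and the doubled integer shift
  preserves parity.\<close>

lemma half_fun_frac_shift:
  assumes "\<And>k::int. \<bar>2 * y - of_int k\<bar> \<ge> 2 * \<epsilon>" and "\<bar>\<delta>\<bar> < \<epsilon>"
  shows "half_fun (frac (y + of_int p + \<delta>)) = half_fun (frac y)"
proof -
  have "\<bar>2 * y - of_int \<lfloor>2 * y\<rfloor>\<bar> \<ge> 2 * \<epsilon>" "\<bar>2 * y - of_int (\<lfloor>2 * y\<rfloor> + 1)\<bar> \<ge> 2 * \<epsilon>"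
    by (rule assms(1))+
  then have "\<lfloor>2 * (y + of_int p + \<delta>)\<rfloor> = \<lfloor>2 * y\<rfloor> + 2 * p"
    using assms(2) by (intro floor_unique) (simp; linarith)+
  then show ?thesis
    by (simp add: half_fun_frac_parity)
qed

text \<open>Uniformity in \<open>x\<close> lets the induction apply the property at a translated
  base point.\<close>

definition oscillates :: "real \<Rightarrow> nat \<Rightarrow> nat \<Rightarrow> bool" where
  "oscillates \<theta> L m \<longleftrightarrow> (\<forall>x. \<exists>i\<le>L. \<exists>j\<le>L. erg_sum \<theta> i x - erg_sum \<theta> j x \<ge> real m)"

text \<open>The two denominators have different tasks: \<open>q\<close> separates the times at which
  the orbit is near a discontinuity, and \<open>q'\<close> is the return time whose displacement is
  too small to matter at the remaining times.\<close>

lemma oscillates_step: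
  assumes q: "good_denominator \<theta> q p" "8 * L \<le> q"
    and q': "good_denominator \<theta> q' p'" "8 * q \<le> q'"
    and osc: "oscillates \<theta> L m"
  shows "oscillates \<theta> (2 * L + q') (Suc m)"
  unfolding oscillates_def
proof
  fix x
  \<comment> \<open>Then \<open>4 * \<epsilon>\<close> is exactly the separation distance for
    \<open>q\<close>, while \<open>8 * q \<le> q'\<close> keeps the displacement by
    \<open>q'\<close> below \<epsilon>.\<close>
  define \<epsilon> where "\<epsilon> = 1 / (8 * real q)"
  define near where "near = (\<lambda>t::nat. \<exists>k::int. \<bar>2 * (x + real t * \<theta>) - of_int k\<bar> < 2 * \<epsilon>)"
  have q0: "q > 0" and q'0: "q' > 0"
    using q(1) q'(1) odd_pos by (auto simp: good_denominator_def)
  have sep: False if st: "near s" "near t" "s < t" "t < 2 * L" for s t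
  proof -
    obtain k l :: int where kl: "\<bar>2 * (x + real s * \<theta>) - of_int k\<bar> < 2 * \<epsilon>"
        "\<bar>2 * (x + real t * \<theta>) - of_int l\<bar> < 2 * \<epsilon>"
      using st unfolding near_def by blast
    have "real (2 * (t - s)) * \<theta> - of_int (l - k)
        = (2 * (x + real t * \<theta>) - of_int l) - (2 * (x + real s * \<theta>) - of_int k)"
      using st by (simp add: of_nat_diff algebra_simps)
    then have "\<bar>real (2 * (t - s)) * \<theta> - of_int (l - k)\<bar> < 4 * \<epsilon>"
      using kl by linarith
    moreover have "4 * \<epsilon> = 1 / (2 * real q)" by (simp add: \<epsilon>_def)
    moreover have "\<bar>real (2 * (t - s)) * \<theta> - of_int (l - k)\<bar> \<ge> 1 / (2 * real q)"
      using st q(2) by (intro good_denominator_separation[OF q(1)]) auto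
    ultimately show False by linarith
  qed
  \<comment> \<open>At most one of the first \<open>2 * L\<close> times is near. If it lies in the
    first half, the second half is free; otherwise the first half is.\<close>
  have "\<exists>r\<le>L. \<forall>t. r \<le> t \<and> t < r + L \<longrightarrow> \<not> near t"
  proof (cases "\<exists>t<L. near t")
    case True
    then obtain s where "s < L" "near s" by blast
    then show ?thesis
      using sep[of s] by (intro exI[of _ L]) force
  next
    case False
    then show ?thesis by (intro exI[of _ 0]) auto
  qed
  then obtain r where r: "r \<le> L" "\<And>t. r \<le> t \<Longrightarrow> t < r + L \<Longrightarrow> \<not> near t" by blast
  define y where "y = x + real r * \<theta>"
  define \<delta> where "\<delta> = real q' * \<theta> - of_int p'"
  have "\<bar>\<delta>\<bar> < 1 / real q'" using q'(1) by (simp add: good_denominator_def \<delta>_def)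
  also have "\<dots> \<le> \<epsilon>"
    unfolding \<epsilon>_def using q'(2) q0 by (intro divide_left_mono) auto
  finally have \<delta>: "\<bar>\<delta>\<bar> < \<epsilon>" .
  have same: "erg_sum \<theta> i (y + real q' * \<theta>) = erg_sum \<theta> i y" if "i \<le> L" for i
    unfolding erg_sum_def
  proof (rule sum.cong[OF refl])
    fix t assume "t \<in> {..<i}"
    then have "\<not> near (r + t)" using r(2)[of "r + t"] that by simp
    moreover have "y + real t * \<theta> = x + real (r + t) * \<theta>"
      by (simp add: y_def algebra_simps)
    ultimately have "\<bar>2 * (y + real t * \<theta>) - of_int k\<bar> \<ge> 2 * \<epsilon>" for k :: int
      unfolding near_def by (metis linorder_not_less)
    from half_fun_frac_shift[OF this \<delta>, of p']
    show "half_fun (frac (y + real q' * \<theta> + real t * \<theta>)) = half_fun (frac (y + real t * \<theta>))"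
      by (simp add: \<delta>_def algebra_simps)
  qed
  have shifted: "erg_sum \<theta> (r + (q' + i)) x = erg_sum \<theta> r x + erg_sum \<theta> q' y + erg_sum \<theta> i y"
    if "i \<le> L" for i
    using same[OF that] by (simp add: erg_sum_add y_def)
  have unshifted: "erg_sum \<theta> (r + i) x = erg_sum \<theta> r x + erg_sum \<theta> i y" for i
    by (simp add: erg_sum_add y_def)
  obtain i j where ij: "i \<le> L" "j \<le> L" "erg_sum \<theta> i y - erg_sum \<theta> j y \<ge> real m"
    using osc unfolding oscillates_def by blast
  obtain s :: int where s: "erg_sum \<theta> q' y = of_int s" "even s \<longleftrightarrow> even q'"
    using erg_sum_parity by blast
  have "odd s" using s(2) q'(1) by (simp add: good_denominator_def)
  then have "s \<noteq> 0" by auto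
  \<comment> \<open>The sign of \<open>s\<close> decides whether the higher or the lower of the two
    sums is taken from the translated copy of the window.\<close>
  then consider "s \<ge> 1" | "s \<le> -1" by linarith
  then show "\<exists>i\<le>2 * L + q'. \<exists>j\<le>2 * L + q'. erg_sum \<theta> i x - erg_sum \<theta> j x \<ge> real (Suc m)"
  proof cases
    case 1
    then have "erg_sum \<theta> (r + (q' + i)) x - erg_sum \<theta> (r + j) x \<ge> real (Suc m)"
      using ij(3) s(1) shifted[OF ij(1)] unshifted[of j] by simp
    moreover have "r + (q' + i) \<le> 2 * L + q'" "r + j \<le> 2 * L + q'"
      using ij r(1) by auto
    ultimately show ?thesis by metis
  next
    case 2
    then have "of_int s \<le> (-1::real)" by linarith
    then have "erg_sum \<theta> (r + i) x - erg_sum \<theta> (r + (q' + j)) x \<ge> real (Suc m)"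
      using ij(3) s(1) shifted[OF ij(2)] unshifted[of i] by simp
    moreover have "r + i \<le> 2 * L + q'" "r + (q' + j) \<le> 2 * L + q'"
      using ij r(1) by auto
    ultimately show ?thesis by metis
  qed
qed

text \<open>One more unit of oscillation costs a bounded factor in window length: \<open>K\<close>
  combines \<open>2 * L\<close> with the bound on \<open>q'\<close> after two choices of a good
  denominator.\<close>

lemma oscillates_power:
  assumes "finite_type \<theta>"
  obtains K :: nat where "K \<ge> 2" "\<And>m. oscillates \<theta> (K ^ m) m"
proof -
  obtain B where B: "\<And>N. N \<ge> 1 \<Longrightarrow> \<exists>q p. N \<le> q \<and> q \<le> B * N \<and> good_denominator \<theta> q p"
    using finite_type_good_denominators[OF assms] by blast
  define K where "K = 2 + B * (8 * (B * 8))"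
  have "oscillates \<theta> (K ^ m) m" for m
  proof (induction m)
    case 0
    show ?case unfolding oscillates_def by (metis diff_self of_nat_0 order_refl)
  next
    case (Suc m)
    define L where "L = K ^ m"
    have L: "L \<ge> 1" by (simp add: L_def K_def)
    then obtain q p where q: "8 * L \<le> q" "q \<le> B * (8 * L)" "good_denominator \<theta> q p"
      using B[of "8 * L"] by auto
    then obtain q' p' where q': "8 * q \<le> q'" "q' \<le> B * (8 * q)" "good_denominator \<theta> q' p'"
      using B[of "8 * q"] L by auto
    have osc: "oscillates \<theta> (2 * L + q') (Suc m)"
      using oscillates_step[OF q(3,1) q'(3,1)] Suc unfolding L_def by blast
    have "B * (8 * q) \<le> B * (8 * (B * (8 * L)))"
      using q(2) by (intro mult_le_mono2)
    with q'(2) have "2 * L + q' \<le> 2 * L + B * (8 * (B * (8 * L)))" by linarith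
    also have "\<dots> = K ^ Suc m" by (simp add: K_def L_def algebra_simps)
    finally show ?case
      using osc unfolding oscillates_def by (meson order_trans)
  qed
  then show ?thesis using that[of K] by (simp add: K_def)
qed

lemma erg_sum_oscillation:
  assumes "finite_type \<theta>"
  obtains c where "c > 0" "\<forall>\<^sub>F n in sequentially. \<forall>x. \<exists>i\<in>{1..n - 1}. \<exists>j\<in>{1..n - 1}.
    erg_sum \<theta> i x - erg_sum \<theta> j x \<ge> c * ln (real n)"
proof -
  obtain K :: nat where K: "K \<ge> 2" "\<And>m. oscillates \<theta> (K ^ m) m"
    using oscillates_power[OF assms] by blast
  \<comment> \<open>With \<open>m\<close> at most \<open>2 * c * ln n\<close>, the window
    \<open>K ^ m\<close> is at most the power 2/3 of \<open>n\<close>. The threshold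
    \<open>K ^ 3\<close> gives \<open>c * ln n \<ge> 1\<close>, so rounding down still leaves
    \<open>m\<close> at least \<open>c * ln n\<close>.\<close>
  define c where "c = 1 / (3 * ln (real K))"
  have lnK: "ln (real K) > 0" using K(1) by simp
  have "\<exists>i\<in>{1..n - 1}. \<exists>j\<in>{1..n - 1}. erg_sum \<theta> i x - erg_sum \<theta> j x \<ge> c * ln (real n)"
    if n: "n \<ge> K ^ 3" for n x
  proof -
    have n8: "n \<ge> 8" using power_mono[OF K(1), of 3] n by simp
    define m where "m = nat \<lfloor>2 * c * ln (real n)\<rfloor>"
    have "1 \<le> c * ln (real n)"
    proof -
      have "3 * ln (real K) = ln (real (K ^ 3))" using K(1) by (simp add: ln_realpow)
      also have "\<dots> \<le> ln (real n)" using n n8 K(1) by (subst ln_le_cancel_iff) auto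
      finally show ?thesis using lnK by (simp add: c_def field_simps)
    qed
    then have m: "c * ln (real n) \<le> real m" "real m \<le> 2 * c * ln (real n)"
      unfolding m_def by linarith+
    have "3 * (real m * ln (real K)) \<le> 2 * ln (real n)"
      using m(2) lnK unfolding c_def by (simp add: field_simps)
    then have "ln (real ((K ^ m) ^ 3)) \<le> ln (real (n ^ 2))"
      using K(1) n8 by (simp add: ln_realpow)
    then have "real ((K ^ m) ^ 3) \<le> real (n ^ 2)"
      using K(1) n8 by (subst (asm) ln_le_cancel_iff) auto
    \<comment> \<open>The exponent 2/3 is kept as a comparison of natural powers; it suffices
      because \<open>(n - 1) ^ 3\<close> exceeds \<open>n ^ 2\<close> from 8 on.\<close>
    then have cube: "(K ^ m) ^ 3 \<le> n ^ 2" by (simp only: of_nat_le_iff)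
    have "K ^ m + 1 \<le> n - 1"
    proof (rule ccontr)
      assume "\<not> ?thesis"
      then have "n - 1 \<le> K ^ m" by simp
      then have "(n - 1) ^ 3 \<le> (K ^ m) ^ 3" by (rule power_mono) simp
      with cube have le: "(n - 1) ^ 3 \<le> n ^ 2" by linarith
      obtain k where k: "n = k + 8" using n8 by (metis add.commute le_Suc_ex)
      show False using le unfolding k by (simp add: power2_eq_square power3_eq_cube algebra_simps)
    qed
    \<comment> \<open>Starting at \<open>x + \<theta>\<close> moves all indices up by one, since the
      extrema exclude index 0; the common first summand cancels.\<close>
    moreover obtain i j where ij: "i \<le> K ^ m" "j \<le> K ^ m"
        "erg_sum \<theta> i (x + \<theta>) - erg_sum \<theta> j (x + \<theta>) \<ge> real m"
      using K(2)[of m] unfolding oscillates_def by blast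
    moreover have "erg_sum \<theta> (1 + i) x - erg_sum \<theta> (1 + j) x
        = erg_sum \<theta> i (x + \<theta>) - erg_sum \<theta> j (x + \<theta>)"
      by (simp only: erg_sum_add) simp
    ultimately show ?thesis
      using m(1) by (intro bexI[of _ "1 + i"] bexI[of _ "1 + j"]) auto
  qed
  then have "\<forall>\<^sub>F n in sequentially. \<forall>x. \<exists>i\<in>{1..n - 1}. \<exists>j\<in>{1..n - 1}.
      erg_sum \<theta> i x - erg_sum \<theta> j x \<ge> c * ln (real n)"
    unfolding eventually_sequentially by blast
  moreover have "c > 0" using lnK by (simp add: c_def)
  ultimately show ?thesis using that by blast
qed

section \<open>Growth of the extrema\<close>

lemma erg_sum_le_max_sum: "i \<in> {1..n - 1} \<Longrightarrow> erg_sum \<theta> i x \<le> max_sum \<theta> n x"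
  unfolding max_sum_def by (intro Max_ge) auto

lemma min_sum_le_erg_sum: "i \<in> {1..n - 1} \<Longrightarrow> min_sum \<theta> n x \<le> erg_sum \<theta> i x"
  unfolding min_sum_def by (intro Min_le) auto

lemma max_sum_attained: "n \<ge> 2 \<Longrightarrow> \<exists>i\<in>{1..n - 1}. max_sum \<theta> n x = erg_sum \<theta> i x"
  using Max_in[of "(\<lambda>i. erg_sum \<theta> i x) ` {1..n - 1}"] unfolding max_sum_def image_iff
  by auto

lemma min_sum_attained: "n \<ge> 2 \<Longrightarrow> \<exists>i\<in>{1..n - 1}. min_sum \<theta> n x = erg_sum \<theta> i x"
  using Min_in[of "(\<lambda>i. erg_sum \<theta> i x) ` {1..n - 1}"] unfolding min_sum_def image_iff
  by auto

lemma eventually_ln_ge: "\<forall>\<^sub>F n in sequentially. c \<le> ln (real n)"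
  using filterlim_compose[OF ln_at_top filterlim_real_sequentially]
  unfolding filterlim_at_top by blast

text \<open>Both extrema are attained, so the bound for single sums applies; once
  \<open>ln n \<ge> 1\<close>, doubling the constant absorbs the additive term.\<close>

lemma extrema_upper_bound:
  assumes "finite_type \<theta>"
  obtains C where "\<forall>\<^sub>F n in sequentially. \<bar>max_sum \<theta> n x\<bar> \<le> C * ln (real n)"
    "\<forall>\<^sub>F n in sequentially. \<bar>min_sum \<theta> n x\<bar> \<le> C * ln (real n)"
proof -
  obtain C where C: "C > 0" "\<And>n x. n \<ge> 1 \<Longrightarrow> \<bar>erg_sum \<theta> n x\<bar> \<le> C * (1 + ln (real n))"
    using erg_sum_upper_bound[OF assms] by blast
  have bound: "\<bar>erg_sum \<theta> i x\<bar> \<le> 2 * C * ln (real n)" if "i \<in> {1..n - 1}" "1 \<le> ln (real n)" for i n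
  proof -
    have "ln (real i) \<le> ln (real n)" using that by (subst ln_le_cancel_iff) auto
    then have "C * (1 + ln (real i)) \<le> C * (2 * ln (real n))"
      using that C(1) by (intro mult_left_mono) auto
    then show ?thesis using C(2)[of i x] that by simp
  qed
  have ev: "\<forall>\<^sub>F n in sequentially. 2 \<le> n \<and> 1 \<le> ln (real n)"
    by (intro eventually_conj eventually_ge_at_top eventually_ln_ge)
  show ?thesis
    by (rule that[of "2 * C"]; rule eventually_mono[OF ev])
       (metis bound max_sum_attained min_sum_attained)+
qed

lemma extrema_difference:
  assumes "finite_type \<theta>"
  obtains c where "c > 0"
    "\<forall>\<^sub>F n in sequentially. c * ln (real n) \<le> max_sum \<theta> n x - min_sum \<theta> n x"
proof -
  obtain c where c: "c > 0" "\<forall>\<^sub>F n in sequentially. \<forall>x. \<exists>i\<in>{1..n - 1}. \<exists>j\<in>{1..n - 1}.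
      erg_sum \<theta> i x - erg_sum \<theta> j x \<ge> c * ln (real n)"
    using erg_sum_oscillation[OF assms] by blast
  have "\<forall>\<^sub>F n in sequentially. c * ln (real n) \<le> max_sum \<theta> n x - min_sum \<theta> n x"
    using c(2)
  proof eventually_elim
    case (elim n)
    then obtain i j where "i \<in> {1..n - 1}" "j \<in> {1..n - 1}"
        "erg_sum \<theta> i x - erg_sum \<theta> j x \<ge> c * ln (real n)" by blast
    then show ?case
      using erg_sum_le_max_sum[of i n \<theta> x] min_sum_le_erg_sum[of j n \<theta> x] by linarith
  qed
  with c(1) show ?thesis using that by blast
qed

lemma small_o_lnD:
  assumes "u \<in> o(\<lambda>n. ln (real n))" and "c > 0"
  shows "\<forall>\<^sub>F n in sequentially. \<bar>u n\<bar> \<le> c * ln (real n)"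
  using landau_o.smallD[OF assms] eventually_ln_ge[of 0] by eventually_elim simp

text \<open>Were the sums eventually below \<open>c/4\<close> times the logarithm, both extrema
  would be too, and their difference would be at most half of its lower bound.\<close>

lemma erg_sum_not_small_o:
  assumes "finite_type \<theta>"
  shows "(\<lambda>n. \<bar>erg_sum \<theta> n x\<bar>) \<notin> o(\<lambda>n. ln (real n))"
proof
  assume o: "(\<lambda>n. \<bar>erg_sum \<theta> n x\<bar>) \<in> o(\<lambda>n. ln (real n))"
  obtain c where c: "c > 0" "\<forall>\<^sub>F n in sequentially. c * ln (real n) \<le> max_sum \<theta> n x - min_sum \<theta> n x"
    using extrema_difference[OF assms] by blast
  obtain n0 where n0: "\<And>n. n \<ge> n0 \<Longrightarrow> \<bar>erg_sum \<theta> n x\<bar> \<le> c / 4 * ln (real n)"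
    using small_o_lnD[OF o, of "c / 4"] c(1) unfolding eventually_sequentially by auto
  have "\<forall>\<^sub>F n in sequentially. False"
    \<comment> \<open>The last threshold makes \<open>c / 4 * ln n\<close> at least
      \<open>n0\<close>, which covers the early sums not controlled by the small-o
      assumption.\<close>
    using c(2) eventually_ge_at_top[of 2] eventually_ln_ge[of 1] eventually_ln_ge[of "4 * real n0 / c"]
  proof eventually_elim
    case (elim n)
    have "\<bar>erg_sum \<theta> i x\<bar> \<le> c / 4 * ln (real n)" if i: "i \<in> {1..n - 1}" for i
    proof (cases "n0 \<le> i")
      case True
      have "ln (real i) \<le> ln (real n)" using i by (subst ln_le_cancel_iff) auto
      then have "c / 4 * ln (real i) \<le> c / 4 * ln (real n)"
        using c(1) by (intro mult_left_mono) auto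
      then show ?thesis using n0[OF True] by linarith
    next
      case False
      then have "\<bar>erg_sum \<theta> i x\<bar> \<le> real n0" using abs_erg_sum_le[of \<theta> i x] by linarith
      also have "\<dots> \<le> c / 4 * ln (real n)" using elim(4) c(1) by (simp add: field_simps)
      finally show ?thesis .
    qed
    then have "max_sum \<theta> n x \<le> c / 4 * ln (real n)" "- (c / 4 * ln (real n)) \<le> min_sum \<theta> n x"
      using max_sum_attained[OF elim(2), of \<theta> x] min_sum_attained[OF elim(2), of \<theta> x]
      by (force simp: abs_le_iff)+
    then have "c * ln (real n) \<le> c / 2 * ln (real n)" using elim(1) by linarith
    then show False using c(1) elim(3) by (simp add: field_simps)
  qed
  then show False by simp
qed

lemma comparable_logI:
  assumes "c > 0" "\<forall>\<^sub>F n in sequentially. c * ln (real n) \<le> u n"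
    and "\<forall>\<^sub>F n in sequentially. u n \<le> C * ln (real n)"
  shows "comparable_log u"
proof -
  have "\<forall>\<^sub>F n in sequentially. c \<le> u n / ln (real n) \<and> u n / ln (real n) \<le> C"
    using assms(2,3) eventually_ln_ge[of 1] by eventually_elim (simp add: field_simps)
  then show ?thesis using assms(1) unfolding comparable_log_def by blast
qed

theorem corollary1p5:
  fixes \<theta> x :: real
  assumes "0 < \<theta>" and "\<theta> < 1"
    and "finite_type \<theta>"
    and "x \<in> {0..<1}"
  shows "(\<lambda>n. \<bar>erg_sum \<theta> n x\<bar>) \<notin> o(\<lambda>n. ln (real n)) \<and>
    ((\<lambda>n. min_sum \<theta> n x) \<in> o(\<lambda>n. ln (real n)) \<longrightarrow> comparable_log (\<lambda>n. max_sum \<theta> n x)) \<and>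
    ((\<lambda>n. max_sum \<theta> n x) \<in> o(\<lambda>n. ln (real n)) \<longrightarrow> comparable_log (\<lambda>n. \<bar>min_sum \<theta> n x\<bar>))"
proof (intro conjI impI)
  obtain c where c: "c > 0" "\<forall>\<^sub>F n in sequentially. c * ln (real n) \<le> max_sum \<theta> n x - min_sum \<theta> n x"
    using extrema_difference[OF assms(3)] by blast
  obtain C where C: "\<forall>\<^sub>F n in sequentially. \<bar>max_sum \<theta> n x\<bar> \<le> C * ln (real n)"
    "\<forall>\<^sub>F n in sequentially. \<bar>min_sum \<theta> n x\<bar> \<le> C * ln (real n)"
    using extrema_upper_bound[OF assms(3)] by blast
  \<comment> \<open>An extremum that is \<open>o(ln n)\<close> accounts for at most half of the gap
    \<open>c * ln n\<close>; the other extremum supplies the rest.\<close>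
  have c2: "c / 2 > 0" using c(1) by simp
  show "(\<lambda>n. \<bar>erg_sum \<theta> n x\<bar>) \<notin> o(\<lambda>n. ln (real n))"
    by (rule erg_sum_not_small_o[OF assms(3)])
  show "comparable_log (\<lambda>n. max_sum \<theta> n x)" if "(\<lambda>n. min_sum \<theta> n x) \<in> o(\<lambda>n. ln (real n))"
  proof (rule comparable_logI[OF c2])
    show "\<forall>\<^sub>F n in sequentially. c / 2 * ln (real n) \<le> max_sum \<theta> n x"
      using c(2) small_o_lnD[OF that c2] by eventually_elim (simp add: field_simps)
    show "\<forall>\<^sub>F n in sequentially. max_sum \<theta> n x \<le> C * ln (real n)"
      using C(1) by eventually_elim simp
  qed
  show "comparable_log (\<lambda>n. \<bar>min_sum \<theta> n x\<bar>)" if "(\<lambda>n. max_sum \<theta> n x) \<in> o(\<lambda>n. ln (real n))"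
  proof (rule comparable_logI[OF c2])
    show "\<forall>\<^sub>F n in sequentially. c / 2 * ln (real n) \<le> \<bar>min_sum \<theta> n x\<bar>"
      using c(2) small_o_lnD[OF that c2] by eventually_elim linarith
    show "\<forall>\<^sub>F n in sequentially. \<bar>min_sum \<theta> n x\<bar> \<le> C * ln (real n)"
      by (rule C(2))
  qed
qed

end
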